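(* Let $X$ be a finite non-void simplicial complex on vertex set $V$. Let $S(X)$ be the collection of all sets $\{v_1,\ldots,v_k\}\subset V$ (with $k\ge 0$) satisfying the following condition: there exist maximal faces $\sigma_1,\sigma_2,\ldots,\sigma_{k+1}$ of $X$ such that - $v_i\notin\sigma_i$ for all $1\le i\le k$, and - $v_i\in\sigma_j$ for all $1\le i<j\le k+1$. Let $d'(X)$ be the maximum size of a set in $S(X)$. Then $X$ is $d'(X)$-collapsible.
   Context: Simplicial complexes are finite abstract simplicial complexes (families of finite sets closed under taking subsets); a non-void complex contains the empty simplex, and the void complex $\emptyset$ has no simplices at all (so it differs from $\{\emptyset\}$). Let $X$ be a finite simplicial complex, and let $\eta\in X$ be a simplex (possibly empty) such that $|\eta|\le d$ and $\eta$ is contained in a unique maximal face $\tau$ of $X$. The complex $X'=X\setminus\{\sigma\in X:\ \eta\subset\sigma\subset\tau\}$ is said to be obtained from $X$ by an elementary $d$-collapse. $X$ is $d$-collapsible if there is a finite sequence of elementary $d$-collapses from $X$ to the void complex. *)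

theory Defs
  imports Main
begin

text \<open>
  Elements of \<open>V\<close> need not be vertices of \<open>X\<close>. The void complex \<open>{}\<close> and the complex
  \<open>{{}}\<close> are both complexes.
\<close>

definition simplicial_complex_on :: "'a set \<Rightarrow> 'a set set \<Rightarrow> bool" where
  "simplicial_complex_on V X \<longleftrightarrow>
     finite X \<and> (\<forall>\<sigma>\<in>X. finite \<sigma> \<and> \<sigma> \<subseteq> V) \<and> (\<forall>\<sigma>\<in>X. \<forall>\<rho>. \<rho> \<subseteq> \<sigma> \<longrightarrow> \<rho> \<in> X)"

definition maximal_face :: "'a set set \<Rightarrow> 'a set \<Rightarrow> bool" where
  "maximal_face X \<tau> \<longleftrightarrow> \<tau> \<in> X \<and> (\<forall>\<rho>\<in>X. \<tau> \<subseteq> \<rho> \<longrightarrow> \<rho> = \<tau>)"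

definition elementary_collapse :: "nat \<Rightarrow> 'a set set \<Rightarrow> 'a set set \<Rightarrow> bool" where
  "elementary_collapse d X X' \<longleftrightarrow>
     (\<exists>\<eta> \<tau>. \<eta> \<in> X \<and> card \<eta> \<le> d \<and>
            maximal_face X \<tau> \<and> \<eta> \<subseteq> \<tau> \<and>
            (\<forall>\<rho>. maximal_face X \<rho> \<and> \<eta> \<subseteq> \<rho> \<longrightarrow> \<rho> = \<tau>) \<and>
            X' = X - {\<sigma> \<in> X. \<eta> \<subseteq> \<sigma> \<and> \<sigma> \<subseteq> \<tau>})"

definition collapsible :: "nat \<Rightarrow> 'a set set \<Rightarrow> bool" where
  "collapsible d X \<longleftrightarrow> (elementary_collapse d)\<^sup>*\<^sup>* X {}"

text \<open>
  The collection \<open>S(X)\<close>. The two conditions on \<open>v\<close> and \<open>\<sigma>\<close> force \<open>v\<close> to be injective on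
  \<open>{1..k}\<close>, so that \<open>k\<close> is the size of the set. For \<open>k = 0\<close> the set is empty and any
  maximal face serves as \<open>\<sigma> 1\<close>.
\<close>

definition S_sets :: "'a set \<Rightarrow> 'a set set \<Rightarrow> 'a set set" where
  "S_sets V X =
     {A. A \<subseteq> V \<and>
         (\<exists>(k::nat) (v :: nat \<Rightarrow> 'a) (\<sigma> :: nat \<Rightarrow> 'a set).
            A = v ` {1..k} \<and>
            (\<forall>i\<in>{1..k+1}. maximal_face X (\<sigma> i)) \<and>
            (\<forall>i\<in>{1..k}. v i \<notin> \<sigma> i) \<and>
            (\<forall>i j. 1 \<le> i \<and> i < j \<and> j \<le> k + 1 \<longrightarrow> v i \<in> \<sigma> j))}"

definition d_prime :: "'a set \<Rightarrow> 'a set set \<Rightarrow> nat" where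
  "d_prime V X = Max (card ` S_sets V X)"

text \<open>The maximum defining \<open>d_prime\<close> is over a finite nonempty set when \<open>X\<close> is non-void.\<close>

lemma S_sets_subset:
  assumes "simplicial_complex_on V X"
  shows "S_sets V X \<subseteq> X"
proof
  fix A assume "A \<in> S_sets V X"
  then obtain k v \<sigma> where A: "A = v ` {1..k::nat}"
    and m: "\<forall>i\<in>{1..k+1}. maximal_face X (\<sigma> i)"
    and c: "\<forall>i j. 1 \<le> i \<and> i < j \<and> j \<le> k + 1 \<longrightarrow> v i \<in> \<sigma> j"
    unfolding S_sets_def by blast
  have "\<sigma> (k+1) \<in> X" using m by (simp add: maximal_face_def)
  moreover have "A \<subseteq> \<sigma> (k+1)" using A c by auto
  ultimately show "A \<in> X" using assms unfolding simplicial_complex_on_def by blast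
qed

lemma finite_S_sets: "simplicial_complex_on V X \<Longrightarrow> finite (S_sets V X)"
  using S_sets_subset finite_subset unfolding simplicial_complex_on_def by metis

lemma empty_in_S_sets:
  assumes "simplicial_complex_on V X" and "X \<noteq> {}"
  shows "{} \<in> S_sets V X"
proof -
  have "finite X" using assms by (simp add: simplicial_complex_on_def)
  then obtain \<tau> where "\<tau> \<in> X" "\<forall>\<rho>\<in>X. \<tau> \<subseteq> \<rho> \<longrightarrow> \<tau> = \<rho>"
    using finite_has_maximal[OF _ assms(2)] by blast
  then have "maximal_face X \<tau>" by (auto simp: maximal_face_def)
  then show ?thesis unfolding S_sets_def
    by (auto intro!: exI[of _ "0::nat"] exI[of _ "\<lambda>_. \<tau>"])
qed

lemma elementary_collapse_complex:
  assumes "simplicial_complex_on V X" and "elementary_collapse d X X'"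
  shows "simplicial_complex_on V X'"
proof -
  obtain \<eta> \<tau> where u: "\<forall>\<rho>. maximal_face X \<rho> \<and> \<eta> \<subseteq> \<rho> \<longrightarrow> \<rho> = \<tau>"
    and X': "X' = X - {\<sigma> \<in> X. \<eta> \<subseteq> \<sigma> \<and> \<sigma> \<subseteq> \<tau>}"
    using assms(2) unfolding elementary_collapse_def by blast
  have fin: "finite X" and f: "\<forall>\<sigma>\<in>X. finite \<sigma> \<and> \<sigma> \<subseteq> V"
    and down: "\<And>\<sigma> \<rho>. \<sigma> \<in> X \<Longrightarrow> \<rho> \<subseteq> \<sigma> \<Longrightarrow> \<rho> \<in> X"
    using assms(1) unfolding simplicial_complex_on_def by blast+
  have le: "\<sigma> \<subseteq> \<tau>" if s: "\<sigma> \<in> X" "\<eta> \<subseteq> \<sigma>" for \<sigma>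
  proof -
    obtain m where m: "m \<in> X" "\<sigma> \<subseteq> m" "\<forall>b\<in>X. m \<subseteq> b \<longrightarrow> m = b"
      using finite_has_maximal2[OF fin s(1)] by blast
    then have "maximal_face X m" by (auto simp: maximal_face_def)
    then show ?thesis using u m s by blast
  qed
  have X'': "X' = {\<sigma> \<in> X. \<not> \<eta> \<subseteq> \<sigma>}" using X' le by blast
  show ?thesis unfolding simplicial_complex_on_def
    using fin f down by (auto simp: X'')
qed

end

theory Submission imports Defs begin

text \<open>
  The proof is by induction on the complex, removing one vertex \<open>v\<close> of \<open>X\<close> at a time. Write \<open>L\<close> for
  the link and \<open>D\<close> for the deletion of \<open>v\<close>, so that \<open>X = D \<union> insert v ` L\<close>. An elementary
  \<open>d\<close>-collapse of \<open>L\<close> at \<open>\<eta>\<close> becomes an elementary \<open>(d+1)\<close>-collapse of \<open>X\<close> at \<open>insert v \<eta>\<close>, which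
  leaves \<open>D\<close> alone. Hence if \<open>L\<close> is \<open>d\<close>-collapsible, then \<open>X\<close> can be brought down to \<open>D\<close> by
  \<open>(d+1)\<close>-collapses (\<open>collapse_link_to_deletion\<close>).

  The collection \<open>S(X)\<close> fits this recursion. Sequences for \<open>D\<close> give sequences for
  \<open>X\<close> with the same vertices (\<open>S_sets_deletion\<close>), since every maximal face of \<open>D\<close> is a maximal face of \<open>X\<close> with \<open>v\<close> possibly
  removed. If some maximal face \<open>\<sigma>\<close> of \<open>X\<close> misses \<open>v\<close>, then the pair \<open>(v, \<sigma>)\<close> can be put in front
  of any sequence for \<open>L\<close> (\<open>S_sets_link\<close>), so the bound on the sizes for \<open>L\<close> is smaller by one, as
  the collapse above requires. If no maximal face misses \<open>v\<close>, then \<open>X\<close> is a cone over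
  \<open>L = D\<close>, and the collapses of \<open>L\<close> extend to the cone without any increase of dimension
  (\<open>collapsible_cone\<close>).
\<close>

section \<open>Elementary collapses\<close>

lemma maximal_face_above:
  assumes "finite X" and "\<sigma> \<in> X"
  obtains \<tau> where "maximal_face X \<tau>" and "\<sigma> \<subseteq> \<tau>"
proof -
  obtain \<tau> where "\<tau> \<in> X" "\<sigma> \<subseteq> \<tau>" "\<forall>\<rho>\<in>X. \<tau> \<subseteq> \<rho> \<longrightarrow> \<tau> = \<rho>"
    using finite_has_maximal2[OF assms] by blast
  moreover from this have "maximal_face X \<tau>" unfolding maximal_face_def by blast
  ultimately show ?thesis using that by blast
qed

text \<open>
  In a finite family every face lies in a maximal one, so a unique maximal face above \<open>\<eta>\<close> is the
  same as a largest face above \<open>\<eta>\<close>. The latter form mentions no maximal faces, which makes it easy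
  to transport along \<open>insert v\<close>.
\<close>

lemma elementary_collapse_iff:
  assumes "finite X"
  shows "elementary_collapse d X X' \<longleftrightarrow>
    (\<exists>\<eta> \<tau>. \<eta> \<in> X \<and> \<tau> \<in> X \<and> card \<eta> \<le> d \<and> \<eta> \<subseteq> \<tau> \<and>
      (\<forall>\<sigma>\<in>X. \<eta> \<subseteq> \<sigma> \<longrightarrow> \<sigma> \<subseteq> \<tau>) \<and> X' = {\<sigma> \<in> X. \<not> \<eta> \<subseteq> \<sigma>})"
    (is "?lhs \<longleftrightarrow> ?rhs")
proof
  assume ?lhs
  then obtain \<eta> \<tau> where *: "\<eta> \<in> X" "card \<eta> \<le> d" "maximal_face X \<tau>" "\<eta> \<subseteq> \<tau>"
      "\<forall>\<rho>. maximal_face X \<rho> \<and> \<eta> \<subseteq> \<rho> \<longrightarrow> \<rho> = \<tau>"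
      "X' = X - {\<sigma> \<in> X. \<eta> \<subseteq> \<sigma> \<and> \<sigma> \<subseteq> \<tau>}"
    unfolding elementary_collapse_def by blast
  have le: "\<sigma> \<subseteq> \<tau>" if "\<sigma> \<in> X" "\<eta> \<subseteq> \<sigma>" for \<sigma>
    using maximal_face_above[OF assms that(1)] *(5) that(2) by (metis subset_trans)
  have "\<tau> \<in> X" using *(3) by (simp add: maximal_face_def)
  moreover have "X' = {\<sigma> \<in> X. \<not> \<eta> \<subseteq> \<sigma>}" using *(6) le by blast
  ultimately show ?rhs using * le by blast
next
  assume ?rhs
  then obtain \<eta> \<tau> where *: "\<eta> \<in> X" "\<tau> \<in> X" "card \<eta> \<le> d" "\<eta> \<subseteq> \<tau>"
      "\<forall>\<sigma>\<in>X. \<eta> \<subseteq> \<sigma> \<longrightarrow> \<sigma> \<subseteq> \<tau>" "X' = {\<sigma> \<in> X. \<not> \<eta> \<subseteq> \<sigma>}"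
    by blast
  have m: "maximal_face X \<tau>"
    unfolding maximal_face_def
  proof (intro conjI ballI impI)
    fix \<rho> assume "\<rho> \<in> X" "\<tau> \<subseteq> \<rho>"
    then have "\<rho> \<subseteq> \<tau>" using *(4,5) subset_trans by metis
    then show "\<rho> = \<tau>" using \<open>\<tau> \<subseteq> \<rho>\<close> by (rule subset_antisym)
  qed (rule *(2))
  have u: "\<forall>\<rho>. maximal_face X \<rho> \<and> \<eta> \<subseteq> \<rho> \<longrightarrow> \<rho> = \<tau>"
    using *(2,5) unfolding maximal_face_def by metis
  have "X' = X - {\<sigma> \<in> X. \<eta> \<subseteq> \<sigma> \<and> \<sigma> \<subseteq> \<tau>}" using *(5,6) by blast
  then show ?lhs unfolding elementary_collapse_def using * m u by blast
qed

lemma elementary_collapse_subset: "elementary_collapse d X X' \<Longrightarrow> X' \<subseteq> X"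
  unfolding elementary_collapse_def by blast

lemma elementary_collapse_link:
  assumes "elementary_collapse d L L'" and fin: "finite L" "finite D"
    and v: "v \<notin> \<Union>L" "v \<notin> \<Union>D"
  shows "elementary_collapse (Suc d) (D \<union> insert v ` L) (D \<union> insert v ` L')"
proof -
  obtain \<eta> \<tau> where *: "\<eta> \<in> L" "\<tau> \<in> L" "card \<eta> \<le> d" "\<eta> \<subseteq> \<tau>"
      "\<forall>\<sigma>\<in>L. \<eta> \<subseteq> \<sigma> \<longrightarrow> \<sigma> \<subseteq> \<tau>" and L': "L' = {\<sigma> \<in> L. \<not> \<eta> \<subseteq> \<sigma>}"
    using assms(1) unfolding elementary_collapse_iff[OF fin(1)] by (elim exE conjE)
  have "v \<notin> \<eta>" using * v by blast
  then have iff: "insert v \<eta> \<subseteq> insert v \<sigma> \<longleftrightarrow> \<eta> \<subseteq> \<sigma>" for \<sigma> by blast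
  have "card (insert v \<eta>) \<le> Suc d" using *(3) card_insert_le_m1[of "Suc d" \<eta> v] by simp
  moreover have "\<forall>\<sigma> \<in> D \<union> insert v ` L. insert v \<eta> \<subseteq> \<sigma> \<longrightarrow> \<sigma> \<subseteq> insert v \<tau>"
  proof (intro ballI impI)
    fix \<sigma> assume \<sigma>: "\<sigma> \<in> D \<union> insert v ` L" "insert v \<eta> \<subseteq> \<sigma>"
    then obtain \<rho> where \<rho>: "\<rho> \<in> L" "\<sigma> = insert v \<rho>" using v(2) by blast
    then have "\<rho> \<subseteq> \<tau>" using \<sigma>(2) iff *(5) by metis
    then show "\<sigma> \<subseteq> insert v \<tau>" using \<rho>(2) by blast
  qed
  moreover have "D \<union> insert v ` L' = {\<sigma> \<in> D \<union> insert v ` L. \<not> insert v \<eta> \<subseteq> \<sigma>}"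
    using v(2) unfolding L' by (auto simp: iff simp del: insert_subset)
  moreover have "insert v \<eta> \<subseteq> insert v \<tau>" using *(4) by blast
  moreover have "finite (D \<union> insert v ` L)" using fin by simp
  moreover have "insert v \<eta> \<in> D \<union> insert v ` L" "insert v \<tau> \<in> D \<union> insert v ` L"
    using *(1,2) by blast+
  ultimately show ?thesis by (subst elementary_collapse_iff) (assumption, intro exI conjI)
qed

lemma collapse_link_to_deletion:
  assumes "collapsible d L" and "finite L" "finite D" "v \<notin> \<Union>L" "v \<notin> \<Union>D"
  shows "(elementary_collapse (Suc d))\<^sup>*\<^sup>* (D \<union> insert v ` L) D"
  using assms(1)[unfolded collapsible_def] assms(2-)
proof (induction rule: converse_rtranclp_induct)
  case base
  then show ?case by simp
next
  case (step L L')
  have "L' \<subseteq> L" using elementary_collapse_subset step.hyps(1) .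
  then have "finite L'" "v \<notin> \<Union>L'" using step.prems finite_subset by blast+
  then show ?case
    using step.IH elementary_collapse_link[OF step.hyps(1)] step.prems
    by (meson converse_rtranclp_into_rtranclp)
qed

text \<open>
  The same \<open>\<eta>\<close> works for the cone, because \<open>v \<notin> \<eta>\<close>: the largest face above it grows from \<open>\<tau>\<close> to
  \<open>insert v \<tau>\<close>, and the faces removed are those removed from the base and their unions with \<open>{v}\<close>.
\<close>

lemma elementary_collapse_cone:
  assumes "elementary_collapse d L L'" and fin: "finite L" and v: "v \<notin> \<Union>L"
  shows "elementary_collapse d (L \<union> insert v ` L) (L' \<union> insert v ` L')"
proof -
  obtain \<eta> \<tau> where *: "\<eta> \<in> L" "\<tau> \<in> L" "card \<eta> \<le> d" "\<eta> \<subseteq> \<tau>"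
      "\<forall>\<sigma>\<in>L. \<eta> \<subseteq> \<sigma> \<longrightarrow> \<sigma> \<subseteq> \<tau>" and L': "L' = {\<sigma> \<in> L. \<not> \<eta> \<subseteq> \<sigma>}"
    using assms(1) unfolding elementary_collapse_iff[OF fin(1)] by (elim exE conjE)
  have "v \<notin> \<eta>" using * v by blast
  then have iff: "\<eta> \<subseteq> insert v \<sigma> \<longleftrightarrow> \<eta> \<subseteq> \<sigma>" for \<sigma> by blast
  have "\<forall>\<sigma> \<in> L \<union> insert v ` L. \<eta> \<subseteq> \<sigma> \<longrightarrow> \<sigma> \<subseteq> insert v \<tau>"
  proof (intro ballI impI)
    fix \<sigma> assume \<sigma>: "\<sigma> \<in> L \<union> insert v ` L" "\<eta> \<subseteq> \<sigma>"
    then obtain \<rho> where \<rho>: "\<rho> \<in> L" "\<sigma> \<subseteq> insert v \<rho>" "\<eta> \<subseteq> \<rho>" using iff by blast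
    then have "\<rho> \<subseteq> \<tau>" using *(5) by metis
    then show "\<sigma> \<subseteq> insert v \<tau>" using \<rho>(2) by blast
  qed
  moreover have "L' \<union> insert v ` L' = {\<sigma> \<in> L \<union> insert v ` L. \<not> \<eta> \<subseteq> \<sigma>}"
    unfolding L' by (auto simp: iff)
  moreover have "\<eta> \<subseteq> insert v \<tau>" using *(4) by blast
  moreover have "finite (L \<union> insert v ` L)" using fin by simp
  moreover have "\<eta> \<in> L \<union> insert v ` L" "insert v \<tau> \<in> L \<union> insert v ` L"
    using *(1,2) by blast+
  ultimately show ?thesis using *(3)
    by (subst elementary_collapse_iff) (assumption, intro exI conjI)
qed

lemma collapsible_cone:
  assumes "collapsible d L" and "finite L" "v \<notin> \<Union>L"
  shows "collapsible d (L \<union> insert v ` L)"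
  using assms(1)[unfolded collapsible_def] assms(2-) unfolding collapsible_def
proof (induction rule: converse_rtranclp_induct)
  case base
  then show ?case by simp
next
  case (step L L')
  have "L' \<subseteq> L" using elementary_collapse_subset step.hyps(1) .
  then have "finite L'" "v \<notin> \<Union>L'" using step.prems finite_subset by blast+
  then show ?case
    using step.IH elementary_collapse_cone[OF step.hyps(1)] step.prems
    by (meson converse_rtranclp_into_rtranclp)
qed

lemma collapsible_singleton_empty: "collapsible d {{}}"
  unfolding collapsible_def
  by (rule r_into_rtranclp, subst elementary_collapse_iff) auto

section \<open>Links and deletions of vertices\<close>

definition link :: "'a set set \<Rightarrow> 'a \<Rightarrow> 'a set set" where
  "link X v = {\<sigma>. v \<notin> \<sigma> \<and> insert v \<sigma> \<in> X}"

definition deletion :: "'a set set \<Rightarrow> 'a \<Rightarrow> 'a set set" where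
  "deletion X v = {\<sigma> \<in> X. v \<notin> \<sigma>}"

lemma simplicial_complex_on_downward:
  "simplicial_complex_on V X \<Longrightarrow> \<sigma> \<in> X \<Longrightarrow> \<rho> \<subseteq> \<sigma> \<Longrightarrow> \<rho> \<in> X"
  unfolding simplicial_complex_on_def by metis

lemma simplicial_complex_on_finite: "simplicial_complex_on V X \<Longrightarrow> finite X"
  by (simp add: simplicial_complex_on_def)

lemma link_subset_deletion:
  "simplicial_complex_on V X \<Longrightarrow> link X v \<subseteq> deletion X v"
  unfolding link_def deletion_def
  by (auto intro: simplicial_complex_on_downward[OF _ _ subset_insertI])

lemma simplicial_complex_on_deletion:
  "simplicial_complex_on V X \<Longrightarrow> simplicial_complex_on V (deletion X v)"
  unfolding simplicial_complex_on_def deletion_def by auto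

lemma simplicial_complex_on_link:
  assumes "simplicial_complex_on V X"
  shows "simplicial_complex_on V (link X v)"
proof -
  have sub: "link X v \<subseteq> X"
    using link_subset_deletion[OF assms] unfolding deletion_def by blast
  moreover have "\<rho> \<in> link X v" if "\<sigma> \<in> link X v" "\<rho> \<subseteq> \<sigma>" for \<sigma> \<rho>
    using that simplicial_complex_on_downward[OF assms, of "insert v \<sigma>" "insert v \<rho>"]
    unfolding link_def by blast
  ultimately show ?thesis
    using assms finite_subset[OF sub] unfolding simplicial_complex_on_def
    by (metis subsetD)
qed

lemma deletion_Un_link: "deletion X v \<union> insert v ` link X v = X"
proof (intro equalityI subsetI)
  fix \<sigma> assume "\<sigma> \<in> X"
  show "\<sigma> \<in> deletion X v \<union> insert v ` link X v"
  proof (cases "v \<in> \<sigma>")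
    case True
    then have "insert v (\<sigma> - {v}) = \<sigma>" by blast
    moreover from this have "\<sigma> - {v} \<in> link X v" using \<open>\<sigma> \<in> X\<close> unfolding link_def by simp
    ultimately show ?thesis by blast
  next
    case False
    then show ?thesis using \<open>\<sigma> \<in> X\<close> by (simp add: deletion_def)
  qed
qed (auto simp: link_def deletion_def)

lemma maximal_face_link:
  assumes "maximal_face (link X v) \<sigma>"
  shows "maximal_face X (insert v \<sigma>)"
proof -
  have \<sigma>: "v \<notin> \<sigma>" "insert v \<sigma> \<in> X" "\<And>\<rho>. \<rho> \<in> link X v \<Longrightarrow> \<sigma> \<subseteq> \<rho> \<Longrightarrow> \<rho> = \<sigma>"
    using assms unfolding maximal_face_def link_def by blast+
  have "\<rho> = insert v \<sigma>" if "\<rho> \<in> X" "insert v \<sigma> \<subseteq> \<rho>" for \<rho>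
  proof -
    have "\<rho> = insert v (\<rho> - {v})" using that by blast
    moreover have "\<rho> - {v} \<in> link X v" using that calculation unfolding link_def by simp
    moreover have "\<sigma> \<subseteq> \<rho> - {v}" using that \<sigma>(1) by blast
    ultimately show ?thesis using \<sigma>(3) by metis
  qed
  then show ?thesis using \<sigma>(2) unfolding maximal_face_def by blast
qed

lemma maximal_face_deletion:
  assumes "simplicial_complex_on V X" and "maximal_face (deletion X v) \<sigma>"
  shows "\<exists>\<rho>. maximal_face X \<rho> \<and> \<sigma> = \<rho> - {v}"
proof -
  have \<sigma>: "\<sigma> \<in> X" "v \<notin> \<sigma>" using assms(2) unfolding maximal_face_def deletion_def by blast+
  obtain \<rho> where \<rho>: "maximal_face X \<rho>" "\<sigma> \<subseteq> \<rho>"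
    using maximal_face_above simplicial_complex_on_finite[OF assms(1)] \<sigma>(1) by blast
  have "\<rho> - {v} \<in> deletion X v"
    using \<rho>(1) simplicial_complex_on_downward[OF assms(1) _ Diff_subset]
    unfolding deletion_def maximal_face_def by simp
  moreover have "\<sigma> \<subseteq> \<rho> - {v}" using \<rho>(2) \<sigma>(2) by blast
  ultimately show ?thesis using assms(2) \<rho>(1) unfolding maximal_face_def by metis
qed

lemma link_eq_deletion_if_cone:
  assumes "simplicial_complex_on V X" and "\<And>\<sigma>. maximal_face X \<sigma> \<Longrightarrow> v \<in> \<sigma>"
  shows "link X v = deletion X v"
proof
  show "deletion X v \<subseteq> link X v"
  proof
    fix \<sigma> assume "\<sigma> \<in> deletion X v"
    then have \<sigma>: "\<sigma> \<in> X" "v \<notin> \<sigma>" unfolding deletion_def by blast+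
    obtain \<rho> where \<rho>: "maximal_face X \<rho>" "\<sigma> \<subseteq> \<rho>"
      using maximal_face_above simplicial_complex_on_finite[OF assms(1)] \<sigma>(1) by blast
    then have "\<rho> \<in> X" "insert v \<sigma> \<subseteq> \<rho>" using assms(2) unfolding maximal_face_def by blast+
    then show "\<sigma> \<in> link X v"
      using simplicial_complex_on_downward[OF assms(1)] \<sigma>(2) unfolding link_def by blast
  qed
qed (rule link_subset_deletion[OF assms(1)])

section \<open>The collection \<open>S(X)\<close> under links and deletions\<close>

text \<open>
  Putting \<open>v\<close> back into the maximal faces that witness \<open>A \<in> S(D)\<close> cannot spoil the condition
  \<open>w\<^sub>i \<notin> \<sigma>\<^sub>i\<close>: every \<open>w\<^sub>i\<close> lies in the last face of \<open>D\<close>, hence differs from \<open>v\<close>.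
\<close>

lemma S_sets_deletion:
  assumes "simplicial_complex_on V X"
  shows "S_sets V (deletion X v) \<subseteq> S_sets V X"
proof
  fix A assume "A \<in> S_sets V (deletion X v)"
  then obtain k w \<sigma> where A: "A \<subseteq> V" "A = w ` {1..k::nat}"
    and m: "\<forall>i\<in>{1..k+1}. maximal_face (deletion X v) (\<sigma> i)"
    and n: "\<forall>i\<in>{1..k}. w i \<notin> \<sigma> i"
    and c: "\<forall>i j. 1 \<le> i \<and> i < j \<and> j \<le> k + 1 \<longrightarrow> w i \<in> \<sigma> j"
    unfolding S_sets_def by blast
  have "\<forall>i\<in>{1..k+1}. \<exists>\<rho>. maximal_face X \<rho> \<and> \<sigma> i = \<rho> - {v}"
    using m maximal_face_deletion[OF assms] by blast
  then obtain \<rho> where \<rho>: "\<forall>i\<in>{1..k+1}. maximal_face X (\<rho> i) \<and> \<sigma> i = \<rho> i - {v}"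
    by metis
  have "w i \<noteq> v" if "i \<in> {1..k}" for i
  proof -
    have "w i \<in> \<sigma> (k+1)" using that c by simp
    moreover have "\<sigma> (k+1) = \<rho> (k+1) - {v}" using \<rho> by simp
    ultimately show ?thesis by blast
  qed
  moreover have "\<sigma> i = \<rho> i - {v}" if "i \<in> {1..k}" for i using \<rho> that by simp
  ultimately have "\<forall>i\<in>{1..k}. w i \<notin> \<rho> i" using n by blast
  moreover have "\<forall>i j. 1 \<le> i \<and> i < j \<and> j \<le> k + 1 \<longrightarrow> w i \<in> \<rho> j"
  proof (intro allI impI)
    fix i j assume ij: "1 \<le> i \<and> i < j \<and> j \<le> k + 1"
    then have "\<sigma> j = \<rho> j - {v}" using \<rho> by simp
    then show "w i \<in> \<rho> j" using c ij by blast
  qed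
  ultimately show "A \<in> S_sets V X" unfolding S_sets_def using A \<rho> by blast
qed

text \<open>
  The sequence for \<open>insert v A\<close> starts with \<open>v\<close> and the face \<open>\<sigma>0\<close>, which misses it. It goes on with
  the sequence for \<open>A\<close>, whose faces all receive \<open>v\<close> on returning from the link to \<open>X\<close>.
\<close>

lemma S_sets_link:
  assumes "simplicial_complex_on V X" and \<sigma>0: "maximal_face X \<sigma>0" "v \<notin> \<sigma>0"
    and "v \<in> V" and "A \<in> S_sets V (link X v)"
  shows "insert v A \<in> S_sets V X"
proof -
  obtain k w \<sigma> where A: "A \<subseteq> V" "A = w ` {1..k::nat}"
    and m: "\<forall>i\<in>{1..k+1}. maximal_face (link X v) (\<sigma> i)"
    and n: "\<forall>i\<in>{1..k}. w i \<notin> \<sigma> i"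
    and c: "\<forall>i j. 1 \<le> i \<and> i < j \<and> j \<le> k + 1 \<longrightarrow> w i \<in> \<sigma> j"
    using assms(5) unfolding S_sets_def by (elim CollectE conjE exE)
  define w' where "w' i = (if i = 1 then v else w (i - 1))" for i
  define \<sigma>' where "\<sigma>' i = (if i = 1 then \<sigma>0 else insert v (\<sigma> (i - 1)))" for i
  have "v \<notin> \<sigma> (k+1)" using m unfolding maximal_face_def link_def by simp
  then have wv: "w i \<noteq> v" if "1 \<le> i" "i \<le> k" for i
  proof -
    have "w i \<in> \<sigma> (k+1)" using c that by simp
    then show ?thesis using \<open>v \<notin> \<sigma> (k+1)\<close> by blast
  qed
  have idx: "{1..k+1} = insert 1 (Suc ` {1..k})" by auto
  have "w' ` Suc ` {1..k} = w ` {1..k}"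
    unfolding image_image by (rule image_cong) (auto simp: w'_def)
  then have A': "insert v A = w' ` {1..k+1}"
    unfolding idx A(2) image_insert by (simp add: w'_def)
  have m': "\<forall>i\<in>{1..(k+1)+1}. maximal_face X (\<sigma>' i)"
  proof
    fix i assume i: "i \<in> {1..(k+1)+1}"
    show "maximal_face X (\<sigma>' i)"
    proof (cases "i = 1")
      case False
      then have "i - 1 \<in> {1..k+1}" using i by auto
      then have "maximal_face (link X v) (\<sigma> (i - 1))" using m by blast
      then have "maximal_face X (insert v (\<sigma> (i - 1)))" by (rule maximal_face_link)
      then show ?thesis using False unfolding \<sigma>'_def by simp
    qed (simp add: \<sigma>'_def \<sigma>0)
  qed
  have n': "\<forall>i\<in>{1..k+1}. w' i \<notin> \<sigma>' i"
  proof
    fix i assume i: "i \<in> {1..k+1}"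
    show "w' i \<notin> \<sigma>' i"
    proof (cases "i = 1")
      case False
      then have "i - 1 \<in> {1..k}" using i by auto
      then show ?thesis using False n wv unfolding \<sigma>'_def w'_def by auto
    qed (simp add: \<sigma>'_def w'_def \<sigma>0)
  qed
  have c': "\<forall>i j. 1 \<le> i \<and> i < j \<and> j \<le> (k + 1) + 1 \<longrightarrow> w' i \<in> \<sigma>' j"
  proof (intro allI impI)
    fix i j assume ij: "1 \<le> i \<and> i < j \<and> j \<le> (k + 1) + 1"
    show "w' i \<in> \<sigma>' j"
    proof (cases "i = 1")
      case False
      then have "1 \<le> i - 1 \<and> i - 1 < j - 1 \<and> j - 1 \<le> k + 1" using ij by linarith
      then have "w (i - 1) \<in> \<sigma> (j - 1)" using c by blast
      then show ?thesis using False ij unfolding \<sigma>'_def w'_def by simp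
    qed (use ij in \<open>simp add: \<sigma>'_def w'_def\<close>)
  qed
  have "insert v A \<subseteq> V" using A assms(4) by blast
  then show ?thesis unfolding S_sets_def
    by (intro CollectI conjI exI[of _ "k+1"] exI[of _ w'] exI[of _ \<sigma>'] A' m' n' c')
qed

section \<open>Collapsibility\<close>

lemma collapsible_if_S_sets_card_le:
  assumes "simplicial_complex_on V X" and "X \<noteq> {}" and "\<forall>A\<in>S_sets V X. card A \<le> d"
  shows "collapsible d X"
  using simplicial_complex_on_finite[OF assms(1)] assms
proof (induction X arbitrary: d rule: finite_psubset_induct)
  case (psubset X)
  note X = psubset.prems(1) and bound = psubset.prems(3)
  have empty: "{} \<in> X" using psubset.prems(2) simplicial_complex_on_downward[OF X] by blast
  show ?case
  proof (cases "X = {{}}")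
    case True
    then show ?thesis using collapsible_singleton_empty by simp
  next
    case False
    then obtain \<sigma> where "\<sigma> \<in> X" "\<sigma> \<noteq> {}" using psubset.prems(2) by auto
    then obtain v where "v \<in> \<sigma>" by blast
    have "\<sigma> \<subseteq> V" using X \<open>\<sigma> \<in> X\<close> unfolding simplicial_complex_on_def by simp
    then have "v \<in> V" using \<open>v \<in> \<sigma>\<close> by blast
    have "{v} \<in> X"
      using simplicial_complex_on_downward[OF X \<open>\<sigma> \<in> X\<close>] \<open>v \<in> \<sigma>\<close> by simp
    let ?L = "link X v" and ?D = "deletion X v"
    have "{} \<in> ?D" "{v} \<notin> ?D" "?D \<subseteq> X" "{} \<in> ?L"
      using empty \<open>{v} \<in> X\<close> unfolding deletion_def link_def by auto
    then have D: "simplicial_complex_on V ?D" "?D \<noteq> {}" "?D \<subset> X"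
      using simplicial_complex_on_deletion[OF X] \<open>{v} \<in> X\<close> by auto
    have L: "simplicial_complex_on V ?L" "?L \<noteq> {}" "?L \<subset> X"
      using simplicial_complex_on_link[OF X] \<open>{} \<in> ?L\<close> link_subset_deletion[OF X, of v] D(3)
      by auto
    have fin: "finite ?L" "finite ?D"
      using simplicial_complex_on_finite L(1) D(1) by blast+
    have notin: "v \<notin> \<Union>?L" "v \<notin> \<Union>?D" unfolding link_def deletion_def by blast+
    have collD: "collapsible d ?D"
      using psubset.IH[OF D(3) D(1,2)] S_sets_deletion[OF X] bound by blast
    show ?thesis
    proof (cases "\<forall>\<sigma>. maximal_face X \<sigma> \<longrightarrow> v \<in> \<sigma>")
      case True
      then have "?L = ?D" using link_eq_deletion_if_cone[OF X] by blast
      then show ?thesis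
        using collapsible_cone[OF collD fin(2) notin(2)] deletion_Un_link[of X v] by simp
    next
      case False
      then obtain \<sigma>0 where \<sigma>0: "maximal_face X \<sigma>0" "v \<notin> \<sigma>0" by blast
      have less: "Suc (card A) \<le> d" if "A \<in> S_sets V ?L" for A
      proof -
        have "A \<in> ?L" using that S_sets_subset[OF L(1)] by blast
        then have "finite A" "v \<notin> A"
          using L(1) unfolding simplicial_complex_on_def link_def by blast+
        then show ?thesis using S_sets_link[OF X \<sigma>0 \<open>v \<in> V\<close> that] bound by fastforce
      qed
      \<comment> \<open>The empty sequence for the link already forces \<open>d\<close> to be positive.\<close>
      have "Suc (card ({} :: 'a set)) \<le> d" using less empty_in_S_sets[OF L(1,2)] by blast
      then obtain e where e: "d = Suc e" by (cases d) auto
      then have "collapsible e ?L" using psubset.IH[OF L(3) L(1,2)] less by auto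
      then have "(elementary_collapse d)\<^sup>*\<^sup>* X ?D"
        using collapse_link_to_deletion[OF _ fin notin] deletion_Un_link[of X v] e by metis
      then show ?thesis using collD unfolding collapsible_def by simp
    qed
  qed
qed

theorem theorem1p4:
  fixes V :: "'a set" and X :: "'a set set"
  assumes "simplicial_complex_on V X" and "X \<noteq> {}"
  shows "collapsible (d_prime V X) X"
proof (rule collapsible_if_S_sets_card_le[OF assms])
  show "\<forall>A\<in>S_sets V X. card A \<le> d_prime V X"
    using finite_S_sets[OF assms(1)] unfolding d_prime_def by simp
qed

end
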